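(* Let $\mathbb{F}_q$ be a finite field, let $\mathcal{C}\subset\mathbb{F}_q[z]^{2k}$ be a $(2k,k)$ convolutional code and let $G(z)\in\mathbb{F}_q[z]^{k\times 2k}$ be a generator matrix of $\mathcal{C}$. Then the following statements are equivalent: (i) $\mathcal{C}$ is self-dual; (ii) $\mathcal{C}$ is non-catastrophic and self-orthogonal; (iii) $\mathcal{C}$ is non-catastrophic and $G(z)G(z)^\top=0$; (iv) $G(z)$ is a parity-check matrix of $\mathcal{C}$.
   Context: An $(n,k)$ convolutional code is an $\mathbb{F}_q[z]$-submodule $\mathcal{C}\subset\mathbb{F}_q[z]^n$ of rank $k$. A generator matrix of $\mathcal{C}$ is a matrix $G(z)\in\mathbb{F}_q[z]^{k\times n}$ whose rows form a basis of $\mathcal{C}$ (so $\mathcal{C}=\mathrm{rowspan}(G(z))$, the $\mathbb{F}_q[z]$-span of the rows). A parity-check matrix of $\mathcal{C}$ is a matrix $H(z)\in\mathbb{F}_q[z]^{(n-k)\times n}$ with $\mathcal{C}=\ker(H(z))=\{v(z)\in\mathbb{F}_q[z]^n : H(z)v(z)^\top=0\}$. A matrix $G(z)\in\mathbb{F}_q[z]^{k\times n}$ is left-prime if in every factorization $G(z)=A(z)\tilde G(z)$ with $A(z)\in\mathbb{F}_q[z]^{k\times k}$, $\tilde G(z)\in\mathbb{F}_q[z]^{k\times n}$, the factor $A(z)$ is unimodular (invertible over $\mathbb{F}_q[z]$). A code is non-catastrophic if it admits a left-prime generator matrix (equivalently all its generator matrices are left-prime). The dual is $\mathcal{C}^\perp=\{f(z)\in\mathbb{F}_q[z]^n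 : f(z)c(z)^\top=0\ \forall c(z)\in\mathcal{C}\}$. $\mathcal{C}$ is self-orthogonal if $\mathcal{C}\subset\mathcal{C}^\perp$ and self-dual if $\mathcal{C}=\mathcal{C}^\perp$. *)

theory Defs
  imports
    "Jordan_Normal_Form.VS_Connect"
    "Jordan_Normal_Form.Matrix_Kernel"
begin

text \<open>
  Elements of $\mathbb{F}_q[z]^n$ are vectors in \<open>carrier_vec n\<close> over \<open>'a poly\<close>, for a finite
  field \<open>'a\<close>. A row vector and its transpose are the same object.
\<close>

abbreviation poly_module :: "nat \<Rightarrow> ('a::field poly, 'a poly vec) module" where
  "poly_module n \<equiv> module_vec TYPE('a poly) n"

definition submodule_basis :: "nat \<Rightarrow> 'a::field poly vec set \<Rightarrow> 'a poly vec set \<Rightarrow> bool" where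
  "submodule_basis n C B \<longleftrightarrow>
     B \<subseteq> carrier_vec n \<and>
     \<not> LinearCombinations.module.lin_dep class_ring (poly_module n) B \<and>
     LinearCombinations.module.span class_ring (poly_module n) B = C"

text \<open>
  Submodules of $\mathbb{F}_q[z]^n$ are free, since $\mathbb{F}_q[z]$ is a principal ideal domain;
  the rank is the cardinality of a basis.
\<close>

definition convolutional_code :: "nat \<Rightarrow> nat \<Rightarrow> 'a::field poly vec set \<Rightarrow> bool" where
  "convolutional_code n k C \<longleftrightarrow>
     LinearCombinations.submodule class_ring C (poly_module n) \<and>
     (\<exists>B. finite B \<and> card B = k \<and> submodule_basis n C B)"

text \<open>
  Linear dependence is a property of sets, so distinctness is what makes the rows
  independent as a family.
\<close>

definition generator_matrix ::
    "nat \<Rightarrow> nat \<Rightarrow> 'a::field poly vec set \<Rightarrow> 'a poly mat \<Rightarrow> bool" where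
  "generator_matrix n k C G \<longleftrightarrow>
     G \<in> carrier_mat k n \<and> distinct (rows G) \<and> submodule_basis n C (set (rows G))"

definition parity_check_matrix ::
    "nat \<Rightarrow> nat \<Rightarrow> 'a::field poly vec set \<Rightarrow> 'a poly mat \<Rightarrow> bool" where
  "parity_check_matrix n k C H \<longleftrightarrow> H \<in> carrier_mat (n - k) n \<and> C = mat_kernel H"

text \<open>
  \<open>invertible_mat\<close> over \<open>'a poly\<close> asks for an inverse with polynomial entries, that is,
  unimodularity.
\<close>

definition left_prime :: "nat \<Rightarrow> nat \<Rightarrow> 'a::field poly mat \<Rightarrow> bool" where
  "left_prime n k G \<longleftrightarrow>
     G \<in> carrier_mat k n \<and>
     (\<forall>A \<in> carrier_mat k k. \<forall>G' \<in> carrier_mat k n. G = A * G' \<longrightarrow> invertible_mat A)"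

definition non_catastrophic :: "nat \<Rightarrow> nat \<Rightarrow> 'a::field poly vec set \<Rightarrow> bool" where
  "non_catastrophic n k C \<longleftrightarrow> (\<exists>G. generator_matrix n k C G \<and> left_prime n k G)"

abbreviation dual_code :: "nat \<Rightarrow> 'a::field poly vec set \<Rightarrow> 'a poly vec set" where
  "dual_code n C \<equiv> vec_module.orthogonal_complement n C"

definition self_orthogonal :: "nat \<Rightarrow> 'a::field poly vec set \<Rightarrow> bool" where
  "self_orthogonal n C \<longleftrightarrow> C \<subseteq> dual_code n C"

definition self_dual :: "nat \<Rightarrow> 'a::field poly vec set \<Rightarrow> bool" where
  "self_dual n C \<longleftrightarrow> C = dual_code n C"

end

theory Submission
  imports Defs
begin

text \<open>
  The dual code is the kernel of any generator matrix \<open>G\<close>, which gives (i) \<open>\<longleftrightarrow>\<close> (iv) and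
  (ii) \<open>\<longleftrightarrow>\<close> (iii). For (i) \<open>\<longleftrightarrow>\<close> (ii), a dual code is saturated (if it contains \<open>p v\<close> with
  \<open>p \<noteq> 0\<close>, it contains \<open>v\<close>), and a code is saturated iff its generator matrices are left-prime.
  It remains to see that \<open>G G\<^sup>T = 0\<close> and \<open>G v = 0\<close> put some nonzero multiple of \<open>v\<close> in the row span:
  choose a set \<open>S\<close> of \<open>k\<close> linearly independent columns of \<open>G\<close>; some nontrivial combination of \<open>v\<close>
  and the rows of \<open>G\<close> vanishes on the other \<open>k\<close> columns; being in the kernel of \<open>G\<close>, it vanishes on
  \<open>S\<close> too.
\<close>

section \<open>Linear systems over an integral domain\<close>

text \<open>Gaussian elimination, by induction on the equations. Cross-multiplication replaces
  division, so an integral domain suffices.\<close>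

lemma homogeneous_system_nontrivial_solution:
  fixes a :: "'i \<Rightarrow> 'j \<Rightarrow> 'b::idom"
  assumes "finite I" "finite J" "card I < card J"
  shows "\<exists>c. (\<exists>j\<in>J. c j \<noteq> 0) \<and> (\<forall>i\<in>I. (\<Sum>j\<in>J. a i j * c j) = 0)"
  using assms
proof (induction I arbitrary: J a rule: finite_induct)
  case empty
  then have "J \<noteq> {}" by auto
  then show ?case by (intro exI[of _ "\<lambda>_. 1"]) auto
next
  case (insert r I)
  show ?case
  proof (cases "\<forall>j\<in>J. a r j = 0")
    case True
    from insert.IH[of J a] insert.prems insert.hyps
    obtain c where "\<exists>j\<in>J. c j \<noteq> 0" "\<forall>i\<in>I. (\<Sum>j\<in>J. a i j * c j) = 0" by auto
    with True show ?thesis by (intro exI[of _ c]) auto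
  next
    case False
    then obtain l where l: "l \<in> J" "a r l \<noteq> 0" by auto
    \<comment> \<open>Equation \<open>i\<close> times the pivot \<open>a r l\<close> minus
      \<open>a i l\<close> times equation \<open>r\<close>: the unknown \<open>l\<close>
      cancels.\<close>
    define b where "b i j = a i j * a r l - a i l * a r j" for i j
    have "card I < card (J - {l})" using insert l by simp
    with insert.IH[of "J - {l}" b] insert.prems
    obtain c where c: "\<exists>j\<in>J - {l}. c j \<noteq> 0"
      "\<And>i. i \<in> I \<Longrightarrow> (\<Sum>j\<in>J - {l}. b i j * c j) = 0" by auto
    define s where "s i = (\<Sum>j\<in>J - {l}. a i j * c j)" for i
    \<comment> \<open>Back-substitution without division: scaling the solution by the pivot lets the
      unknown \<open>l\<close> take the value \<open>- s r\<close>.\<close>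
    define c' where "c' j = (if j = l then - s r else a r l * c j)" for j
    have sum_c': "(\<Sum>j\<in>J. a i j * c' j) = a r l * s i - a i l * s r" for i
    proof -
      have "(\<Sum>j\<in>J. a i j * c' j) = a i l * c' l + (\<Sum>j\<in>J - {l}. a i j * c' j)"
        using insert.prems l by (simp add: sum.remove)
      also have "(\<Sum>j\<in>J - {l}. a i j * c' j) = a r l * s i"
        unfolding s_def sum_distrib_left by (rule sum.cong) (auto simp: c'_def)
      finally show ?thesis by (simp add: c'_def)
    qed
    have "a r l * s i - a i l * s r = 0" if "i \<in> I" for i
    proof -
      have "a r l * s i - a i l * s r = (\<Sum>j\<in>J - {l}. b i j * c j)"
        unfolding s_def sum_distrib_left b_def sum_subtractf[symmetric]
        by (rule sum.cong) (auto simp: algebra_simps)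
      with c(2)[OF that] show ?thesis by simp
    qed
    moreover have "\<exists>j\<in>J. c' j \<noteq> 0" using c(1) l by (auto simp: c'_def)
    ultimately show ?thesis by (intro exI[of _ c']) (auto simp: sum_c')
  qed
qed

text \<open>A maximal set of linearly independent columns does it: with fewer than \<open>card I\<close> of them,
  some nontrivial combination of the rows vanishes on these columns, hence on all columns.\<close>

lemma independent_rows_imp_independent_columns:
  fixes g :: "'i \<Rightarrow> 'j \<Rightarrow> 'b::idom"
  assumes "finite I" "finite J"
    and rows_indep: "\<And>x. (\<And>j. j \<in> J \<Longrightarrow> (\<Sum>i\<in>I. x i * g i j) = 0) \<Longrightarrow> \<forall>i\<in>I. x i = 0"
  shows "\<exists>S\<subseteq>J. card I \<le> card S \<and>
    (\<forall>y. (\<forall>i\<in>I. (\<Sum>j\<in>S. g i j * y j) = 0) \<longrightarrow> (\<forall>j\<in>S. y j = 0))"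
proof -
  define indep where "indep S \<longleftrightarrow> S \<subseteq> J \<and>
    (\<forall>y. (\<forall>i\<in>I. (\<Sum>j\<in>S. g i j * y j) = 0) \<longrightarrow> (\<forall>j\<in>S. y j = 0))" for S
  have "indep {}" by (simp add: indep_def)
  moreover have "\<forall>S. indep S \<longrightarrow> card S < Suc (card J)"
    using \<open>finite J\<close> by (auto simp: indep_def less_Suc_eq_le intro: card_mono)
  ultimately obtain S where S: "indep S" and max: "\<And>T. indep T \<Longrightarrow> card T \<le> card S"
    using ex_has_greatest_nat[of indep "{}" card "Suc (card J)"] by (auto simp: less_imp_le)
  have SJ: "S \<subseteq> J" and fS: "finite S" using S \<open>finite J\<close> finite_subset by (auto simp: indep_def)
  have "card I \<le> card S"
  proof (rule ccontr)
    assume "\<not> card I \<le> card S"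
    then obtain x where x: "\<exists>i\<in>I. x i \<noteq> 0" "\<And>j. j \<in> S \<Longrightarrow> (\<Sum>i\<in>I. g i j * x i) = 0"
      using homogeneous_system_nontrivial_solution[OF fS \<open>finite I\<close>, of "\<lambda>j i. g i j"] by auto
    have "(\<Sum>i\<in>I. g i l * x i) = 0" if l: "l \<in> J" for l
    proof (cases "l \<in> S")
      case False
      then have "\<not> indep (insert l S)" using max[of "insert l S"] fS by auto
      then obtain y where y: "\<And>i. i \<in> I \<Longrightarrow> (\<Sum>j\<in>insert l S. g i j * y j) = 0"
        and nz: "\<exists>j\<in>insert l S. y j \<noteq> 0"
        using l SJ unfolding indep_def by blast
      have y': "g i l * y l + (\<Sum>j\<in>S. g i j * y j) = 0" if "i \<in> I" for i
        using y[OF that] False fS by simp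
      \<comment> \<open>Otherwise \<open>y\<close> would be a dependency among the columns in
        \<open>S\<close> alone.\<close>
      have "y l \<noteq> 0"
      proof
        assume "y l = 0"
        then have "\<forall>j\<in>S. y j = 0" using S y' by (auto simp: indep_def)
        with nz \<open>y l = 0\<close> show False by auto
      qed
      \<comment> \<open>Weight the column dependency \<open>y\<close> by \<open>x\<close> and sum
        over the rows: the columns in \<open>S\<close> contribute 0 by the choice of
        \<open>x\<close>, which leaves \<open>y l\<close> times the wanted sum.\<close>
      have "0 = (\<Sum>i\<in>I. (g i l * y l + (\<Sum>j\<in>S. g i j * y j)) * x i)"
        by (rule sym, rule sum.neutral) (simp add: y')
      also have "\<dots> = y l * (\<Sum>i\<in>I. g i l * x i) + (\<Sum>i\<in>I. \<Sum>j\<in>S. y j * (g i j * x i))"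
        by (simp add: algebra_simps sum.distrib sum_distrib_left)
      also have "(\<Sum>i\<in>I. \<Sum>j\<in>S. y j * (g i j * x i)) = (\<Sum>j\<in>S. y j * (\<Sum>i\<in>I. g i j * x i))"
        by (subst sum.swap) (simp add: sum_distrib_left)
      also have "\<dots> = 0" using x(2) by simp
      finally show ?thesis using \<open>y l \<noteq> 0\<close> by simp
    qed (rule x(2))
    then have "\<forall>i\<in>I. x i = 0" by (intro rows_indep) (simp add: mult.commute)
    with x(1) show False by auto
  qed
  with S show ?thesis by (auto simp: indep_def)
qed

section \<open>Kernel and row span of a matrix with self-orthogonal rows\<close>

lemma mult_mat_vec_smult:
  fixes A :: "'b::comm_ring mat"
  assumes "A \<in> carrier_mat m n" "v \<in> carrier_vec n"
  shows "A *\<^sub>v (c \<cdot>\<^sub>v v) = c \<cdot>\<^sub>v (A *\<^sub>v v)"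
  using assms by (intro eq_vecI) (auto simp: scalar_prod_smult_distrib[of _ n])

lemma mult_mat_unit_vec:
  fixes A :: "'b::semiring_1 mat"
  assumes "A \<in> carrier_mat m n" "j < n"
  shows "A *\<^sub>v unit_vec n j = col A j"
  using assms by (intro eq_vecI) auto

lemma transpose_mult_mat_vec_index:
  fixes G :: "'b::comm_semiring_0 mat"
  assumes "G \<in> carrier_mat k n" "x \<in> carrier_vec k" "j < n"
  shows "(transpose_mat G *\<^sub>v x) $ j = (\<Sum>i<k. x $ i * G $$ (i, j))"
  using assms by (auto simp: scalar_prod_def atLeast0LessThan mult.commute intro!: sum.cong)

lemma scalar_prod_transpose_mult_mat_vec:
  fixes G :: "'b::comm_semiring_0 mat"
  assumes "G \<in> carrier_mat k n" "x \<in> carrier_vec k" "v \<in> carrier_vec n"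
  shows "v \<bullet> (transpose_mat G *\<^sub>v x) = (G *\<^sub>v v) \<bullet> x"
  using assms transpose_vec_mult_scalar[of G k n v x]
  by (metis comm_scalar_prod mult_mat_vec_carrier transpose_carrier_mat)

text \<open>Over the fraction field the row space lies in the kernel and both have dimension
  \<open>k\<close>, so they coincide; \<open>p\<close> is a common denominator of the coefficients
  of \<open>v\<close>.\<close>

lemma kernel_vector_multiple_in_row_span:
  fixes G :: "'b::idom mat"
  assumes G: "G \<in> carrier_mat k n" and n: "n = 2 * k"
    and inj: "\<And>x. x \<in> carrier_vec k \<Longrightarrow> transpose_mat G *\<^sub>v x = 0\<^sub>v n \<Longrightarrow> x = 0\<^sub>v k"
    and GG: "G * transpose_mat G = 0\<^sub>m k k"
    and v: "v \<in> carrier_vec n" and Gv: "G *\<^sub>v v = 0\<^sub>v k"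
  shows "\<exists>p x. p \<noteq> 0 \<and> x \<in> carrier_vec k \<and> p \<cdot>\<^sub>v v = transpose_mat G *\<^sub>v x"
proof -
  have inj': "\<forall>i\<in>{..<k}. x i = 0" if "\<And>j. j \<in> {..<n} \<Longrightarrow> (\<Sum>i<k. x i * G $$ (i, j)) = 0" for x
  proof -
    have "transpose_mat G *\<^sub>v vec k x = 0\<^sub>v n"
      using that G by (intro eq_vecI)
        (auto simp: transpose_mult_mat_vec_index[OF G] simp del: index_mult_mat_vec)
    from inj[OF _ this] show ?thesis by (metis index_vec index_zero_vec(1) lessThan_iff vec_carrier)
  qed
  from independent_rows_imp_independent_columns[of "{..<k}" "{..<n}" "\<lambda>i j. G $$ (i, j)", OF _ _ inj']
  obtain S where S: "S \<subseteq> {..<n}" "k \<le> card S"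
    and Sindep: "\<And>y. (\<And>i. i < k \<Longrightarrow> (\<Sum>j\<in>S. G $$ (i, j) * y j) = 0) \<Longrightarrow> (\<forall>j\<in>S. y j = 0)"
    by auto
  define T where "T = {..<n} - S"
  \<comment> \<open>At most \<open>k\<close> columns lie outside \<open>S\<close>, against
    \<open>k + 1\<close> unknown coefficients.\<close>
  have "card T < card {..k}" using S n by (simp add: T_def card_Diff_subset finite_subset)
  \<comment> \<open>index \<open>k\<close> stands for \<open>v\<close>, indices below \<open>k\<close> for the rows of \<open>G\<close>\<close>
  with homogeneous_system_nontrivial_solution[of T "{..k}" "\<lambda>j i. if i = k then v $ j else G $$ (i, j)"]
  obtain c where c: "\<exists>i\<le>k. c i \<noteq> 0"
    "\<And>j. j \<in> T \<Longrightarrow> (\<Sum>i\<le>k. (if i = k then v $ j else G $$ (i, j)) * c i) = 0"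
    by (auto simp: T_def)
  define w where "w = c k \<cdot>\<^sub>v v + transpose_mat G *\<^sub>v vec k c"
  have w: "w \<in> carrier_vec n" using v G by (auto simp: w_def)
  have w_index: "w $ j = c k * v $ j + (\<Sum>i<k. c i * G $$ (i, j))" if "j < n" for j
    using that v G transpose_mult_mat_vec_index[OF G, of "vec k c" j] by (simp add: w_def)
  have wT: "w $ j = 0" if "j \<in> T" for j
  proof -
    have "(\<Sum>i<k. (if i = k then v $ j else G $$ (i, j)) * c i) = (\<Sum>i<k. c i * G $$ (i, j))"
      by (intro sum.cong) auto
    then show ?thesis
      using c(2)[OF that] that by (simp add: w_index T_def lessThan_Suc_atMost[symmetric] ac_simps)
  qed
  have Gw: "G *\<^sub>v w = 0\<^sub>v k"
  proof -
    have "G *\<^sub>v w = c k \<cdot>\<^sub>v (G *\<^sub>v v) + (G * transpose_mat G) *\<^sub>v vec k c"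
      using v G unfolding w_def
      by (simp add: mult_add_distrib_mat_vec[of _ k n] mult_mat_vec_smult[of _ k n]
          assoc_mult_mat_vec[of _ k n _ k])
    also have "\<dots> = 0\<^sub>v k" by (auto simp: Gv GG)
    finally show ?thesis .
  qed
  have "\<forall>j\<in>S. w $ j = 0"
  proof (rule Sindep)
    fix i assume i: "i < k"
    have "(\<Sum>j\<in>S. G $$ (i, j) * w $ j) = (\<Sum>j<n. G $$ (i, j) * w $ j)"
      using S wT by (intro sum.mono_neutral_left) (auto simp: T_def)
    also have "\<dots> = (G *\<^sub>v w) $ i"
      using i G w by (auto simp: scalar_prod_def atLeast0LessThan)
    finally show "(\<Sum>j\<in>S. G $$ (i, j) * w $ j) = 0" using i by (simp add: Gw)
  qed
  with wT have w0: "w $ j = 0" if "j < n" for j using that by (auto simp: T_def)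
  \<comment> \<open>Otherwise \<open>c\<close> would be a nontrivial relation among the rows of
    \<open>G\<close> alone.\<close>
  have "c k \<noteq> 0"
  proof
    assume "c k = 0"
    with w0 w_index have "\<forall>i\<in>{..<k}. c i = 0" by (intro inj') auto
    with c(1) \<open>c k = 0\<close> show False by (auto simp: le_less)
  qed
  moreover have "c k \<cdot>\<^sub>v v = transpose_mat G *\<^sub>v (- vec k c)"
    using v G w0 by (intro eq_vecI)

      (auto simp: w_index transpose_mult_mat_vec_index[OF G] sum_negf eq_neg_iff_add_eq_0
        simp del: index_mult_mat_vec)
  ultimately show ?thesis by (metis uminus_carrier_vec vec_carrier)
qed

section \<open>Left-primeness implies saturation\<close>

text \<open>The Euclidean algorithm. The measure puts the zero polynomial below the nonzero
  constants, although all of them have degree 0.\<close>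

lemma field_poly_bezout:
  fixes x y :: "'a::field poly"
  shows "\<exists>a b. a * x + b * y dvd x \<and> a * x + b * y dvd y"
proof (induction y arbitrary: x rule: measure_induct_rule[where f = "\<lambda>y. if y = 0 then 0 else Suc (degree y)"])
  case (less y)
  show ?case
  proof (cases "y = 0")
    case True
    then show ?thesis by (intro exI[of _ 1]) simp
  next
    case False
    then have "x mod y = 0 \<or> degree (x mod y) < degree y" by (rule degree_mod_less)
    then have "\<exists>a b. a * y + b * (x mod y) dvd y \<and> a * y + b * (x mod y) dvd x mod y"
      using False by (intro less) auto
    then obtain a b where ab: "a * y + b * (x mod y) dvd y" "a * y + b * (x mod y) dvd x mod y" by auto
    have "a * y + b * (x mod y) = b * x + (a - b * (x div y)) * y"
      by (simp add: minus_div_mult_eq_mod[symmetric] algebra_simps)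
    moreover have "a * y + b * (x mod y) dvd x" using ab by (metis dvd_mod_iff)
    ultimately show ?thesis using ab(1) by metis
  qed
qed

text \<open>If \<open>p\<close> is coprime to \<open>x $ i\<close>, then \<open>p\<close> times some vector is row \<open>i\<close> of \<open>G\<close> plus a
  combination of the other rows. Replacing row \<open>i\<close> by that vector splits off a factor of
  determinant \<open>p\<close> from \<open>G\<close>.\<close>

lemma left_prime_coprime_coefficient:
  fixes G :: "'a::field poly mat"
  assumes lp: "left_prime n k G" and x: "x \<in> carrier_vec k" and v: "v \<in> carrier_vec n"
    and eq: "p \<cdot>\<^sub>v v = transpose_mat G *\<^sub>v x"
    and i: "i < k" and bez: "a * x $ i + b * p = 1"
  shows "p dvd 1"
proof -
  have G: "G \<in> carrier_mat k n" using lp by (simp add: left_prime_def)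
  \<comment> \<open>\<open>A\<close> is the identity outside row \<open>i\<close>. In row
    \<open>i\<close> of \<open>A * G'\<close> the entries \<open>- a * x $ s\<close> cancel the
    other rows contained in \<open>p * a * v\<close>, leaving \<open>a * x $ i + b * p = 1\<close>
    times row \<open>i\<close> of \<open>G\<close>.\<close>
  define A where "A = mat k k (\<lambda>(r, s).
    if r = i then (if s = i then p else - a * x $ s) else if r = s then 1 else 0)"
  define G' where "G' = mat k n (\<lambda>(r, j).
    if r = i then a * v $ j + b * G $$ (i, j) else G $$ (r, j))"
  have A: "A \<in> carrier_mat k k" and G': "G' \<in> carrier_mat k n" by (auto simp: A_def G'_def)
  have "G = A * G'"
  proof (rule eq_matI)
    fix r j assume "r < dim_row (A * G')" "j < dim_col (A * G')"
    then have r: "r < k" and j: "j < n" using A G' by auto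
    have AG: "(A * G') $$ (r, j) = (\<Sum>s<k. A $$ (r, s) * G' $$ (s, j))"
      using r j A G' by (auto simp: scalar_prod_def atLeast0LessThan)
    show "G $$ (r, j) = (A * G') $$ (r, j)"
    proof (cases "r = i")
      case False
      have "(\<Sum>s<k. A $$ (r, s) * G' $$ (s, j)) = (\<Sum>s<k. if r = s then G $$ (r, j) else 0)"
        using r j i False by (intro sum.cong) (auto simp: A_def G'_def)
      then show ?thesis using r AG by simp
    next
      case True
      have pv: "p * v $ j = x $ i * G $$ (i, j) + (\<Sum>s\<in>{..<k} - {i}. x $ s * G $$ (s, j))"
        using arg_cong[OF eq, of "\<lambda>u. u $ j"] j v i transpose_mult_mat_vec_index[OF G x j]
        by (simp add: sum.remove[of "{..<k}" i])
      have "(\<Sum>s<k. A $$ (r, s) * G' $$ (s, j))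
        = p * (a * v $ j + b * G $$ (i, j)) + (\<Sum>s\<in>{..<k} - {i}. A $$ (i, s) * G' $$ (s, j))"
        using i j True by (subst sum.remove[of _ i]) (auto simp: A_def G'_def)
      also have "(\<Sum>s\<in>{..<k} - {i}. A $$ (i, s) * G' $$ (s, j)) =
          - a * (\<Sum>s\<in>{..<k} - {i}. x $ s * G $$ (s, j))"
        unfolding sum_distrib_left using i j by (intro sum.cong) (auto simp: A_def G'_def)
      also have "p * (a * v $ j + b * G $$ (i, j)) + \<dots> = (a * x $ i + b * p) * G $$ (i, j)"
        using arg_cong[OF pv, of "\<lambda>t. a * t"] by (simp add: algebra_simps)
      finally show ?thesis using True AG bez by simp
    qed
  qed (use A G' G in auto)
  with lp A G' have "invertible_mat A" by (auto simp: left_prime_def)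
  then obtain B where AB: "A * B = 1\<^sub>m k" and BA: "B * A = 1\<^sub>m (dim_row B)"
    using A by (auto simp: invertible_mat_def inverts_mat_def)
  \<comment> \<open>The shape of \<open>B\<close> is read off from the column counts of the two
    products.\<close>
  have B: "B \<in> carrier_mat k k"
    using A arg_cong[OF AB, of dim_col] arg_cong[OF BA, of dim_col] by (auto intro: carrier_matI)
  \<comment> \<open>Column \<open>i\<close> of \<open>A\<close> is \<open>p\<close> times a unit
    vector, so this entry is a multiple of \<open>p\<close>.\<close>
  have "1 = (B * A) $$ (i, i)" using BA B i by simp
  also have "\<dots> = (\<Sum>s<k. B $$ (i, s) * A $$ (s, i))"
    using A B i by (auto simp: scalar_prod_def atLeast0LessThan)
  also have "\<dots> = (\<Sum>s<k. if s = i then B $$ (i, i) * p else 0)"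
    using i by (intro sum.cong) (auto simp: A_def)
  also have "\<dots> = B $$ (i, i) * p" using i by simp
  finally show ?thesis by (metis dvd_triv_right)
qed

text \<open>Induction on the degree of \<open>p\<close>. If \<open>p\<close> divides every entry of
  \<open>x\<close>, it cancels; otherwise its gcd with some entry is a proper factor, and
  \<open>p\<close> is removed one factor at a time.\<close>

lemma left_prime_imp_saturated:
  fixes G :: "'a::field poly mat"
  assumes lp: "left_prime n k G" and "x \<in> carrier_vec k" "v \<in> carrier_vec n" "p \<noteq> 0"
    and "p \<cdot>\<^sub>v v = transpose_mat G *\<^sub>v x"
  shows "\<exists>y\<in>carrier_vec k. v = transpose_mat G *\<^sub>v y"
  using assms(2-)
proof (induction "degree p" arbitrary: p x v rule: less_induct)
  case less
  note x = less.prems(1) and v = less.prems(2) and p = less.prems(3) and eq = less.prems(4)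
  have G: "G \<in> carrier_mat k n" using lp by (simp add: left_prime_def)
  show ?case
  proof (cases "\<forall>i<k. p dvd x $ i")
    case True
    define y where "y = vec k (\<lambda>i. x $ i div p)"
    have "x = p \<cdot>\<^sub>v y" using True x by (intro eq_vecI) (auto simp: y_def)
    then have "p \<cdot>\<^sub>v v = p \<cdot>\<^sub>v (transpose_mat G *\<^sub>v y)"
      using eq G mult_mat_vec_smult[of "transpose_mat G" n k y p] by (simp add: y_def)
    then have "p * v $ j = p * (transpose_mat G *\<^sub>v y) $ j" if "j < n" for j
      using that v G by (metis carrier_matD(2) carrier_vecD dim_mult_mat_vec index_smult_vec(1) index_transpose_mat(2))
    then have "v = transpose_mat G *\<^sub>v y" using v G p by (intro eq_vecI) auto
    then show ?thesis by (auto simp: y_def)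
  next
    case False
    then obtain i where i: "i < k" and ndvd: "\<not> p dvd x $ i" by auto
    obtain a b d where d: "d = a * x $ i + b * p" "d dvd x $ i" "d dvd p"
      using field_poly_bezout[of "x $ i" p] by auto
    obtain e where e: "p = d * e" using d(3) by (auto simp: dvd_def)
    have nz: "d \<noteq> 0" "e \<noteq> 0" using p e by auto
    \<comment> \<open>A unit gcd can be scaled to 1, so \<open>p\<close> would be a unit and divide
      \<open>x $ i\<close>.\<close>
    have "\<not> d dvd 1"
    proof
      assume "d dvd 1"
      then obtain d' where "1 = d * d'" by (auto simp: dvd_def)
      then have "(a * d') * x $ i + (b * d') * p = 1" using d(1) by (simp add: algebra_simps)
      from left_prime_coprime_coefficient[OF lp x v eq i this] ndvd show False
        by (meson dvd_trans one_dvd)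
    qed
    moreover have "\<not> e dvd 1"
    proof
      assume "e dvd 1"
      then have "p dvd d" using e by (simp add: mult_dvd_mono[of d d e 1, simplified])
      with d(2) ndvd show False by (meson dvd_trans)
    qed
    ultimately have "degree d < degree p" "degree e < degree p"
      using nz by (auto simp: e degree_mult_eq is_unit_iff_degree)
    \<comment> \<open>First \<open>e\<close> is removed, with \<open>d \<cdot>\<^sub>v v\<close> in
      the role of \<open>v\<close>; then \<open>d\<close>, with the new coefficient vector
      \<open>y\<close>.\<close>
    have "e \<cdot>\<^sub>v (d \<cdot>\<^sub>v v) = transpose_mat G *\<^sub>v x"
      using eq e by (simp add: smult_smult_assoc mult.commute)
    from less.hyps[OF \<open>degree e < degree p\<close> x _ nz(2) this] v
    obtain y where "y \<in> carrier_vec k" "d \<cdot>\<^sub>v v = transpose_mat G *\<^sub>v y" by auto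
    from less.hyps[OF \<open>degree d < degree p\<close> this(1) v nz(1) this(2)] show ?thesis .
  qed
qed

section \<open>Generator matrices as injective linear maps\<close>

lemma generator_matrix_imp_image:
  fixes G :: "'a::field poly mat"
  assumes "generator_matrix n k C G"
  shows "C = (\<lambda>x. transpose_mat G *\<^sub>v x) ` carrier_vec k"
proof -
  interpret idom_vec n "TYPE('a poly)" .
  have G: "G \<in> carrier_mat k n" and C: "C = span (set (rows G))"
    using assms by (auto simp: generator_matrix_def submodule_basis_def)
  have GT: "transpose_mat G = mat_of_cols n (rows G)"
    using G by (auto intro!: eq_matI simp: mat_of_cols_index)
  have rows: "set (rows G) \<subseteq> carrier_vec n" using G by (auto simp: rows_def)
  have "C = range (\<lambda>c. lincomb_list c (rows G))"
    unfolding C span_list_as_span[OF rows, symmetric] span_list_def by auto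
  also have "\<dots> = range (\<lambda>c. transpose_mat G *\<^sub>v vec k c)"
    using rows G unfolding GT by (subst lincomb_list_as_mat_mult) auto
  also have "\<dots> = (\<lambda>x. transpose_mat G *\<^sub>v x) ` carrier_vec k"
  proof (intro equalityI subsetI)
    fix v assume "v \<in> (\<lambda>x. transpose_mat G *\<^sub>v x) ` carrier_vec k"
    then obtain x where x: "x \<in> carrier_vec k" and v: "v = transpose_mat G *\<^sub>v x" by auto
    have "x = vec k (\<lambda>i. x $ i)" using x by auto
    with v show "v \<in> range (\<lambda>c. transpose_mat G *\<^sub>v vec k c)" by (metis rangeI)
  qed auto
  finally show ?thesis .
qed

lemma generator_matrix_imp_inj:
  fixes G :: "'a::field poly mat"
  assumes gen: "generator_matrix n k C G" and x: "x \<in> carrier_vec k"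
    and eq: "transpose_mat G *\<^sub>v x = 0\<^sub>v n"
  shows "x = 0\<^sub>v k"
proof -
  interpret idom_vec n "TYPE('a poly)" .
  have G: "G \<in> carrier_mat k n" and dist: "distinct (rows G)" and indpt: "lin_indpt (set (rows G))"
    using gen by (auto simp: generator_matrix_def submodule_basis_def)
  have GT: "transpose_mat G = mat_of_cols n (rows G)"
    using G by (auto intro!: eq_matI simp: mat_of_cols_index)
  have len: "length (rows G) = k" using G by simp
  \<comment> \<open>Linear combinations range over a set, so \<open>f\<close> collects the
    coefficients of all positions holding the row \<open>l\<close>; distinctness of the rows leaves
    just one.\<close>
  define f where "f l = (\<Sum>i = 0..<length (rows G). if l = rows G ! i then x $ i else 0)" for l
  have "lincomb f (set (rows G)) = 0\<^sub>v n"
    unfolding f_def using eq x G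
    by (subst mat_of_rows_mult_as_finsum[symmetric]) (auto simp: GT)
  then have zero: "f w = 0" if "w \<in> set (rows G)" for w
    using indpt that finite_set[of "rows G"] unfolding lin_dep_def by auto
  show ?thesis
  proof (rule eq_vecI)
    fix i assume "i < dim_vec (0\<^sub>v k :: 'a poly vec)"
    then have i: "i < k" by simp
    have "f (rows G ! i) = (\<Sum>j = 0..<k. if i = j then x $ j else 0)"
      unfolding f_def len using dist i len by (intro sum.cong) (auto simp: nth_eq_iff_index_eq simp del: nth_rows)
    also have "\<dots> = x $ i" using i by simp
    finally show "x $ i = 0\<^sub>v k $ i" using zero[OF nth_mem[of i "rows G"]] i len by simp
  qed (use x in simp)
qed

section \<open>Saturation implies left-primeness\<close>

text \<open>The inverse is the adjugate scaled by the inverse of the determinant.\<close>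

lemma dvd_det_imp_invertible_mat:
  fixes A :: "'b::comm_ring_1 mat"
  assumes A: "A \<in> carrier_mat k k" and "det A dvd 1"
  shows "invertible_mat A"
proof -
  obtain e where e: "1 = det A * e" using assms(2) by (auto simp: dvd_def)
  note adj = adj_mat[OF A]
  have "A * (e \<cdot>\<^sub>m adj_mat A) = 1\<^sub>m k" "(e \<cdot>\<^sub>m adj_mat A) * A = 1\<^sub>m k"
    using adj A e by (auto simp: mult_smult_distrib[of _ k k _ k] mult_smult_assoc_mat[of _ k k _ k] mult.commute intro!: eq_matI)
  then show ?thesis using A adj(1) by (auto simp: invertible_mat_def inverts_mat_def square_mat.simps)
qed

text \<open>If \<open>G = A * G'\<close>, multiplying by the adjugate of \<open>A\<close> puts
  \<open>det A\<close> times each row of \<open>G'\<close> into \<open>C\<close>. Saturation then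
  gives \<open>G' = B * G\<close>, and cancelling \<open>G\<close> in \<open>G = A * B * G\<close>
  makes \<open>A\<close> unimodular.\<close>

lemma saturated_imp_left_prime:
  fixes G :: "'a::field poly mat"
  assumes G: "generator_matrix n k C G"
    and sat: "\<And>p v. p \<noteq> 0 \<Longrightarrow> v \<in> carrier_vec n \<Longrightarrow> p \<cdot>\<^sub>v v \<in> C \<Longrightarrow> v \<in> C"
  shows "left_prime n k G"
  unfolding left_prime_def
proof (intro conjI ballI impI)
  note image = generator_matrix_imp_image[OF G] and inj = generator_matrix_imp_inj[OF G]
  show Gc: "G \<in> carrier_mat k n" using G by (simp add: generator_matrix_def)
  fix A G' assume A: "A \<in> carrier_mat k k" and G': "G' \<in> carrier_mat k n" and eq: "G = A * G'"
  \<comment> \<open>A nonzero kernel vector of the transpose of \<open>A\<close> would also be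
    killed by that of \<open>G\<close>, against injectivity.\<close>
  have "det (transpose_mat A) \<noteq> 0"
  proof
    assume "det (transpose_mat A) = 0"
    then obtain x where x: "x \<in> carrier_vec k" "x \<noteq> 0\<^sub>v k" "transpose_mat A *\<^sub>v x = 0\<^sub>v k"
      using det_0_iff_vec_prod_zero[of "transpose_mat A" k] A by auto
    have "transpose_mat G *\<^sub>v x = transpose_mat G' *\<^sub>v (transpose_mat A *\<^sub>v x)"
      using A G' x(1) by (simp add: eq transpose_mult[of _ k k _ n] assoc_mult_mat_vec[of _ n k _ k])
    also have "\<dots> = 0\<^sub>v n" using x(3) G' by auto
    finally show False using inj x by auto
  qed
  then have det: "det A \<noteq> 0" using A by (simp add: det_transpose)
  have "\<exists>y\<in>carrier_vec k. row G' j = transpose_mat G *\<^sub>v y" if j: "j < k" for j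
  proof -
    have adj: "adj_mat A \<in> carrier_mat k k" "adj_mat A * A = det A \<cdot>\<^sub>m 1\<^sub>m k"
      using adj_mat[OF A] by auto
    have "adj_mat A * G = det A \<cdot>\<^sub>m G'"
      using adj A G' by (simp add: eq assoc_mult_mat[symmetric, of _ k k _ k _ n] mult_smult_assoc_mat[of _ k k _ n])
    then have "det A \<cdot>\<^sub>v row G' j = row (adj_mat A * G) j" using G' j by auto
    also have "\<dots> = transpose_mat G *\<^sub>v row (adj_mat A) j"
      using j adj(1) Gc by (intro eq_vecI) (auto intro!: comm_scalar_prod[of _ k])
    finally have "det A \<cdot>\<^sub>v row G' j \<in> C" using image adj(1) by (auto simp: row_def)
    then have "row G' j \<in> C" using sat det G' j by auto
    then show ?thesis using image by auto
  qed
  then obtain y where y: "\<And>j. j < k \<Longrightarrow> y j \<in> carrier_vec k"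
    "\<And>j. j < k \<Longrightarrow> row G' j = transpose_mat G *\<^sub>v y j" by metis
  define B where "B = mat k k (\<lambda>(j, s). y j $ s)"
  have B: "B \<in> carrier_mat k k" by (simp add: B_def)
  have "row B j = y j" if "j < k" for j using y(1)[OF that] that by (auto simp: B_def)
  have "G' = B * G"
  proof (rule eq_matI)
    fix r j assume "r < dim_row (B * G)" "j < dim_col (B * G)"
    then have r: "r < k" and j: "j < n" using B Gc by auto
    have "G' $$ (r, j) = (transpose_mat G *\<^sub>v y r) $ j" using y(2)[OF r] r j G' by (metis carrier_matD index_row(1))
    also have "\<dots> = (\<Sum>i<k. y r $ i * G $$ (i, j))" by (rule transpose_mult_mat_vec_index[OF Gc y(1)[OF r] j])
    also have "\<dots> = (B * G) $$ (r, j)" using r j Gc B by (auto simp: scalar_prod_def atLeast0LessThan B_def)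
    finally show "G' $$ (r, j) = (B * G) $$ (r, j)" .
  qed (use B Gc G' in auto)
  \<comment> \<open>Cancelling \<open>G\<close> on the right is injectivity of its transpose,
    applied column by column.\<close>
  have "transpose_mat (A * B) = 1\<^sub>m k"
  proof -
    have AB: "A * B \<in> carrier_mat k k" using A B by simp
    have "(A * B) * G = G"
      using eq \<open>G' = B * G\<close> assoc_mult_mat[OF A B Gc] by simp
    then have GT: "transpose_mat G * transpose_mat (A * B) = transpose_mat G"
      using transpose_mult[OF AB Gc] by simp
    have "col (transpose_mat (A * B)) j = unit_vec k j" if j: "j < k" for j
    proof -
      let ?d = "col (transpose_mat (A * B)) j - unit_vec k j"
      have "transpose_mat G *\<^sub>v col (transpose_mat (A * B)) j = col (transpose_mat G) j"
        using col_mult2[of "transpose_mat G" n k "transpose_mat (A * B)" k j] j AB Gc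
        by (simp add: GT del: transpose_mult)
      moreover have "transpose_mat G *\<^sub>v unit_vec k j = col (transpose_mat G) j"
        using Gc j by (simp add: mult_mat_unit_vec[of _ n k])
      ultimately have "transpose_mat G *\<^sub>v ?d = 0\<^sub>v n"
        using Gc A B j by (subst mult_minus_distrib_mat_vec[of _ n k]) auto
      then have d0: "?d = 0\<^sub>v k" using A B j by (intro inj) auto
      show ?thesis
      proof (rule eq_vecI)
        fix i assume "i < dim_vec (unit_vec k j :: 'a poly vec)"
        then have "i < k" by simp
        then show "col (transpose_mat (A * B)) j $ i = unit_vec k j $ i"
          using arg_cong[OF d0, of "\<lambda>u. u $ i"]
          by (metis index_minus_vec(1) index_unit_vec(3) index_zero_vec(1) right_minus_eq)
      qed (use A B in simp)
    qed
    then show ?thesis using A B by (intro mat_col_eqI) auto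
  qed
  then have "A * B = 1\<^sub>m k" by (metis transpose_one transpose_transpose)
  then have "det A * det B = 1" using det_mult[OF A B] by simp
  then have "det A dvd 1" by (metis dvd_triv_left)
  then show "invertible_mat A" by (rule dvd_det_imp_invertible_mat[OF A])
qed

section \<open>Duality and the equivalences\<close>

text \<open>\<open>G\<close> and its transpose are adjoint for the scalar product, and pairing with
  unit vectors detects whether \<open>G *\<^sub>v v\<close> is zero.\<close>

lemma dual_code_eq_mat_kernel:
  fixes G :: "'a::field poly mat"
  assumes G: "generator_matrix n k C G"
  shows "dual_code n C = mat_kernel G"
proof -
  have Gc: "G \<in> carrier_mat k n" using G by (simp add: generator_matrix_def)
  have "(\<forall>y\<in>C. v \<bullet> y = 0) \<longleftrightarrow> G *\<^sub>v v = 0\<^sub>v k" if v: "v \<in> carrier_vec n" for v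
  proof -
    have "(\<forall>y\<in>C. v \<bullet> y = 0) \<longleftrightarrow> (\<forall>x\<in>carrier_vec k. (G *\<^sub>v v) \<bullet> x = 0)"
      using v by (simp add: generator_matrix_imp_image[OF G] scalar_prod_transpose_mult_mat_vec[OF Gc])
    also have "\<dots> \<longleftrightarrow> G *\<^sub>v v = 0\<^sub>v k"
    proof
      assume *: "\<forall>x\<in>carrier_vec k. (G *\<^sub>v v) \<bullet> x = 0"
      have "(G *\<^sub>v v) $ i = 0" if "i < k" for i
        using *[rule_format, of "unit_vec k i"] that Gc v
          scalar_prod_right_unit[of i k "G *\<^sub>v v"] by auto
      then show "G *\<^sub>v v = 0\<^sub>v k" using Gc by (intro eq_vecI) auto
    qed auto
    finally show ?thesis .
  qed
  then show ?thesis
    using Gc by (auto simp: vec_module.orthogonal_complement_def mat_kernel_def)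
qed

lemma self_orthogonal_iff:
  fixes G :: "'a::field poly mat"
  assumes G: "generator_matrix n k C G"
  shows "self_orthogonal n C \<longleftrightarrow> G * transpose_mat G = 0\<^sub>m k k"
proof -
  have Gc: "G \<in> carrier_mat k n" using G by (simp add: generator_matrix_def)
  have "self_orthogonal n C \<longleftrightarrow> (\<forall>x\<in>carrier_vec k. G *\<^sub>v (transpose_mat G *\<^sub>v x) = 0\<^sub>v k)"
    using Gc unfolding self_orthogonal_def dual_code_eq_mat_kernel[OF G]
    by (auto simp: generator_matrix_imp_image[OF G] mat_kernel_def)
  also have "\<dots> \<longleftrightarrow> (\<forall>x\<in>carrier_vec k. (G * transpose_mat G) *\<^sub>v x = 0\<^sub>v k)"
    using Gc by (simp add: assoc_mult_mat_vec[of _ k n _ k])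
  also have "\<dots> \<longleftrightarrow> G * transpose_mat G = 0\<^sub>m k k"
  proof
    assume *: "\<forall>x\<in>carrier_vec k. (G * transpose_mat G) *\<^sub>v x = 0\<^sub>v k"
    have "col (G * transpose_mat G) j = col (0\<^sub>m k k) j" if "j < k" for j
      using *[rule_format, of "unit_vec k j"] that Gc by (simp add: mult_mat_unit_vec[of _ k k])
    then show "G * transpose_mat G = 0\<^sub>m k k" using Gc by (intro mat_col_eqI) auto
  qed auto
  finally show ?thesis .
qed

lemma self_dual_iff:
  fixes C :: "'a::field poly vec set"
  assumes G: "generator_matrix (2 * k) k C G"
  shows "self_dual (2 * k) C \<longleftrightarrow> non_catastrophic (2 * k) k C \<and> self_orthogonal (2 * k) C"
proof
  assume sd: "self_dual (2 * k) C"
  have "left_prime (2 * k) k G"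
  proof (rule saturated_imp_left_prime[OF G])
    fix p :: "'a poly" and v assume "p \<noteq> 0" "v \<in> carrier_vec (2 * k)" "p \<cdot>\<^sub>v v \<in> C"
    moreover have C: "C = {v \<in> carrier_vec (2 * k). \<forall>y\<in>C. v \<bullet> y = 0}"
      using sd by (auto simp: self_dual_def vec_module.orthogonal_complement_def)
    \<comment> \<open>Saturation of a dual: \<open>p\<close> comes out of the scalar product and
      cancels in a domain.\<close>
    ultimately have "\<forall>y\<in>C. p * (v \<bullet> y) = 0"
      by (smt (verit) mem_Collect_eq smult_scalar_prod_distrib)
    then show "v \<in> C" using C \<open>p \<noteq> 0\<close> \<open>v \<in> carrier_vec (2 * k)\<close> by auto
  qed
  with G sd show "non_catastrophic (2 * k) k C \<and> self_orthogonal (2 * k) C"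
    by (auto simp: non_catastrophic_def self_dual_def self_orthogonal_def)
next
  assume *: "non_catastrophic (2 * k) k C \<and> self_orthogonal (2 * k) C"
  \<comment> \<open>The argument runs with a left-prime generator matrix \<open>G0\<close>, which
    may differ from \<open>G\<close>; self-orthogonality concerns \<open>C\<close> only, so it
    applies to \<open>G0\<close> too.\<close>
  then obtain G0 where G0: "generator_matrix (2 * k) k C G0" and lp: "left_prime (2 * k) k G0"
    by (auto simp: non_catastrophic_def)
  have Gc: "G0 \<in> carrier_mat k (2 * k)" using G0 by (simp add: generator_matrix_def)
  have GG: "G0 * transpose_mat G0 = 0\<^sub>m k k" using * self_orthogonal_iff[OF G0] by simp
  have "v \<in> C" if "v \<in> dual_code (2 * k) C" for v
  proof -
    have v: "v \<in> carrier_vec (2 * k)" "G0 *\<^sub>v v = 0\<^sub>v k"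
      using that mat_kernelD[OF Gc] by (simp_all add: dual_code_eq_mat_kernel[OF G0])
    obtain p x where "p \<noteq> 0" "x \<in> carrier_vec k" "p \<cdot>\<^sub>v v = transpose_mat G0 *\<^sub>v x"
      using kernel_vector_multiple_in_row_span[OF Gc refl generator_matrix_imp_inj[OF G0] GG v] by auto
    with left_prime_imp_saturated[OF lp] v(1) show ?thesis
      unfolding generator_matrix_imp_image[OF G0] by blast
  qed
  with * show "self_dual (2 * k) C" by (auto simp: self_dual_def self_orthogonal_def)
qed

theorem theorem6:
  fixes C :: "'a::{field,finite} poly vec set" and G :: "'a poly mat" and k :: nat
  assumes "convolutional_code (2 * k) k C"
    and "generator_matrix (2 * k) k C G"
  shows "(self_dual (2 * k) C \<longleftrightarrow> non_catastrophic (2 * k) k C \<and> self_orthogonal (2 * k) C) \<and>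
    (non_catastrophic (2 * k) k C \<and> self_orthogonal (2 * k) C \<longleftrightarrow>
      non_catastrophic (2 * k) k C \<and> G * transpose_mat G = 0\<^sub>m k k) \<and>
    (non_catastrophic (2 * k) k C \<and> G * transpose_mat G = 0\<^sub>m k k \<longleftrightarrow>
      parity_check_matrix (2 * k) k C G)"
proof -
  have "G \<in> carrier_mat k (2 * k)" using assms(2) by (simp add: generator_matrix_def)
  \<comment> \<open>Since \<open>2 * k - k = k\<close>, \<open>G\<close> has the shape of a
    parity-check matrix, and its kernel is the dual code.\<close>
  then have "parity_check_matrix (2 * k) k C G \<longleftrightarrow> self_dual (2 * k) C"
    by (simp add: parity_check_matrix_def self_dual_def dual_code_eq_mat_kernel[OF assms(2)])
  with self_dual_iff[OF assms(2)] self_orthogonal_iff[OF assms(2)] show ?thesis by blast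
qed

end
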